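(* Let $\mathbb{A}$ be the double arrow space. For every integer $m\geq 2$, the symmetric product $\mathcal{F}_m(\mathbb{A})$ is not homogeneous.
   Context: Let $\mathbb{A}_0=\,]0,1]\times\{0\}$, $\mathbb{A}_1=[0,1[\,\times\{1\}$ and $\mathbb{A}=\mathbb{A}_0\cup\mathbb{A}_1$, ordered lexicographically: $\langle a,r\rangle\prec\langle b,s\rangle$ iff $a<b$, or $a=b$ and $r<s$. The double arrow space is $\mathbb{A}$ with the order topology of $\prec$. For a space $X$, $\mathcal{F}_m(X)$ denotes the set of all nonempty subsets of $X$ of cardinality at most $m$, with the subspace topology inherited from the hyperspace of closed subsets of $X$ with the Vietoris topology. A space $Y$ is homogeneous if for all $x,y\in Y$ there is a homeomorphism $h:Y\to Y$ with $h(x)=y$. *)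

theory Defs
  imports "HOL-Analysis.Analysis"
begin

definition double_arrow_set :: "(real \<times> real) set" where
  "double_arrow_set = ({a. 0 < a \<and> a \<le> 1} \<times> {0}) \<union> ({a. 0 \<le> a \<and> a < 1} \<times> {1})"

definition lex_less :: "real \<times> real \<Rightarrow> real \<times> real \<Rightarrow> bool" where
  "lex_less p q \<longleftrightarrow> fst p < fst q \<or> (fst p = fst q \<and> snd p < snd q)"

text \<open>Order topology of a strict linear order on a carrier set S: generated by
  the open rays (and S itself, to fix the carrier).\<close>
definition order_topology_on :: "'a set \<Rightarrow> ('a \<Rightarrow> 'a \<Rightarrow> bool) \<Rightarrow> 'a topology" where
  "order_topology_on S lt = topology_generated_by
     (insert S ({{x \<in> S. lt x a} | a. a \<in> S} \<union> {{x \<in> S. lt a x} | a. a \<in> S}))"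

definition double_arrow :: "(real \<times> real) topology" where
  "double_arrow = order_topology_on double_arrow_set lex_less"

definition vietoris :: "'a topology \<Rightarrow> 'a set topology" where
  "vietoris X = topology_generated_by
     ({{F. closedin X F \<and> F \<subseteq> U} | U. openin X U} \<union>
      {{F. closedin X F \<and> F \<inter> U \<noteq> {}} | U. openin X U})"

definition sym_product :: "nat \<Rightarrow> 'a topology \<Rightarrow> 'a set topology" where
  "sym_product m X = subtopology (vietoris X)
     {F. F \<subseteq> topspace X \<and> F \<noteq> {} \<and> finite F \<and> card F \<le> m}"

definition homogeneous_space :: "'a topology \<Rightarrow> bool" where
  "homogeneous_space Y \<longleftrightarrow>
     (\<forall>x \<in> topspace Y. \<forall>y \<in> topspace Y. \<exists>h. homeomorphic_map Y Y h \<and> h x = y)"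

end

theory Submission
  imports Defs
begin

text \<open>
  Let \<open>\<pi> = fst\<close> be the two-to-one projection to \<open>[0, 1]\<close>. If \<open>f\<close> is a continuous self-map of the
  symmetric product and \<open>W\<close> is clopen, then for all but finitely many \<open>b\<close> replacing the point \<open>(b, 0)\<close>
  of a set by \<open>(b, 1)\<close> does not affect whether its image under \<open>f\<close> meets \<open>W\<close>: infinitely many
  exceptional \<open>b\<close> would accumulate at some \<open>t\<close> from one side, where \<open>(b, 0)\<close> and \<open>(b, 1)\<close> have
  the same limit. Hence, outside a countable set of parameters \<open>b\<close>, the swap preserves the
  projection of the image, and also its points over any prescribed countable set.

  Suppose that a homeomorphism \<open>h\<close> with inverse \<open>g\<close> maps a singleton to a set with \<open>m\<close> distinct
  projections; then so it does for nearby singletons \<open>{(a, 0)}\<close>. Let \<open>D\<close> be the countable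
  exceptional set of \<open>g\<close>. If two points of \<open>h {(a, 0)}\<close> projected outside \<open>D\<close>, swapping them would give
  four sets which \<open>g\<close> maps into the three-element fibre \<open>{{(a, 0)}, {(a, 1)}, {(a, 0), (a, 1)}}\<close>. So all
  but at most one point lie over \<open>D\<close>. For generic \<open>a\<close> the images under \<open>h\<close> of these three sets have the same
  projection and the same points over \<open>D\<close>, which leaves only two possibilities for three images.
\<close>

section \<open>Limits in generated topologies, and subsequences\<close>

text \<open>Convergence can be tested on a subbase, because the sets that satisfy the
  eventual-membership condition are closed under binary intersections and arbitrary unions. The
  first premise only puts \<open>l\<close> into the underlying space.\<close>

lemma limitin_topology_generated_by:
  assumes "l \<in> \<Union>S"
    and "\<And>U. U \<in> S \<Longrightarrow> l \<in> U \<Longrightarrow> eventually (\<lambda>n. x n \<in> U) F"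
  shows "limitin (topology_generated_by S) x l F"
proof -
  have "l \<in> U \<longrightarrow> eventually (\<lambda>n. x n \<in> U) F" if "generate_topology_on S U" for U
    using that
  proof induction
    case (Int a b)
    then show ?case by (auto intro: eventually_conj)
  next
    case (UN K)
    show ?case
    proof
      assume "l \<in> \<Union>K"
      then obtain k where "k \<in> K" "l \<in> k" by blast
      with UN.IH have "eventually (\<lambda>n. x n \<in> k) F" by blast
      then show "eventually (\<lambda>n. x n \<in> \<Union>K) F"
        by (rule eventually_mono) (use \<open>k \<in> K\<close> in blast)
    qed
  qed (use assms(2) in auto)
  then show ?thesis
    using assms(1) by (simp add: limitin_def openin_topology_generated_by_iff)
qed

lemma eventually_limitin:
  "limitin X x l F \<Longrightarrow> openin X U \<Longrightarrow> l \<in> U \<Longrightarrow> eventually (\<lambda>n. x n \<in> U) F"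
  by (simp add: limitin_def)

lemma limitin_subseq:
  assumes "limitin X x l sequentially" "strict_mono (r :: nat \<Rightarrow> nat)"
  shows "limitin X (\<lambda>n. x (r n)) l sequentially"
  using limitin_subsequence[OF assms(2,1)] by (simp add: o_def)

lemma infinite_imp_subsequence:
  assumes "infinite S"
  obtains r :: "nat \<Rightarrow> nat" where "strict_mono r" "\<And>n. r n \<in> S"
  using strict_mono_enumerate[OF assms] enumerate_in_set[OF assms] by blast

text \<open>Compactness gives the limit, and the pigeonhole principle then keeps the subsequence on
  one side of it. The side matters because it decides which of the two points over \<open>l\<close>
  is the limit in the double arrow space.\<close>

lemma one_sided_convergent_subsequence:
  fixes t :: "nat \<Rightarrow> real"
  assumes "\<And>n. t n \<in> {0..1}"
  obtains r l where "strict_mono r" "l \<in> {0..1}" "(\<lambda>n. t (r n)) \<longlonglongrightarrow> l"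
    "(\<forall>n. t (r n) < l) \<or> (\<forall>n. l < t (r n)) \<or> (\<forall>n. t (r n) = l)"
proof -
  have "seq_compact {0..1::real}"
    by (simp add: compact_imp_seq_compact)
  then obtain l s where l: "l \<in> {0..1}" and s: "strict_mono s" and lim: "(t \<circ> s) \<longlonglongrightarrow> l"
    using assms unfolding seq_compact_def by metis
  let ?A = "{n. t (s n) < l}" and ?B = "{n. l < t (s n)}" and ?C = "{n. t (s n) = l}"
  have "?A \<union> ?B \<union> ?C = UNIV" by force
  then obtain S where "infinite S" "S \<in> {?A, ?B, ?C}"
    by (metis finite_Un infinite_UNIV_nat insertI1 insertI2)
  moreover from this obtain q :: "nat \<Rightarrow> nat" where "strict_mono q" "\<And>n. q n \<in> S"
    using infinite_imp_subsequence by blast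
  ultimately have q: "strict_mono q"
    "(\<forall>n. t (s (q n)) < l) \<or> (\<forall>n. l < t (s (q n))) \<or> (\<forall>n. t (s (q n)) = l)"
    by auto
  show ?thesis
  proof
    show "strict_mono (s \<circ> q)" using s q(1) by (simp add: strict_mono_o)
    show "(\<lambda>n. t ((s \<circ> q) n)) \<longlonglongrightarrow> l"
      using LIMSEQ_subseq_LIMSEQ[OF lim q(1)] by (simp add: o_def)
  qed (use q(2) l in auto)
qed

section \<open>The Vietoris topology and symmetric products\<close>

lemma topspace_vietoris: "topspace (vietoris X) = {F. closedin X F}"
proof (rule antisym)
  have "{F. closedin X F \<and> F \<subseteq> topspace X} \<in> {{F. closedin X F \<and> F \<subseteq> U} | U. openin X U}"
    using openin_topspace by blast
  moreover have "{F. closedin X F} = {F. closedin X F \<and> F \<subseteq> topspace X}"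
    by (auto dest: closedin_subset)
  ultimately show "{F. closedin X F} \<subseteq> topspace (vietoris X)"
    unfolding vietoris_def topology_generated_by_topspace by auto
qed (auto simp: vietoris_def topology_generated_by_topspace)

lemma openin_vietoris_subset: "openin X U \<Longrightarrow> openin (vietoris X) {F. closedin X F \<and> F \<subseteq> U}"
  unfolding vietoris_def by (rule topology_generated_by_Basis) blast

lemma openin_vietoris_hit:
  "openin X U \<Longrightarrow> openin (vietoris X) {F. closedin X F \<and> F \<inter> U \<noteq> {}}"
  unfolding vietoris_def by (rule topology_generated_by_Basis) blast

text \<open>This builds limits of finite sets one point at a time. A containment condition on the
  limit passes to both ingredients, while a hitting condition is witnessed by \<open>l\<close> or by
  \<open>L\<close>. The set \<open>L\<close> may be empty, which lets inductions start
  there.\<close>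

lemma limitin_vietoris_insert:
  assumes X: "t1_space X" and R: "limitin (vietoris X) R L F" and x: "limitin X x l F"
    and xX: "\<And>n. x n \<in> topspace X"
  shows "limitin (vietoris X) (\<lambda>n. insert (x n) (R n)) (insert l L) F"
proof -
  have sing: "closedin X {y}" if "y \<in> topspace X" for y
    using X that by (simp add: t1_space_closedin_singleton)
  have ins: "closedin X (insert y S)" if "y \<in> topspace X" "closedin X S" for y S
    using closedin_Un[OF sing[OF that(1)] that(2)] by simp
  have evR: "eventually (\<lambda>n. closedin X (R n) \<and> R n \<subseteq> U) F" if "openin X U" "L \<subseteq> U" for U
    using R openin_vietoris_subset[OF that(1)] that(2) by (auto simp: limitin_def topspace_vietoris)
  have evH: "eventually (\<lambda>n. closedin X (R n) \<and> R n \<inter> U \<noteq> {}) F" if "openin X U" "L \<inter> U \<noteq> {}" for U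
    using R openin_vietoris_hit[OF that(1)] that(2) by (auto simp: limitin_def topspace_vietoris)
  have evx: "eventually (\<lambda>n. x n \<in> U) F" if "openin X U" "l \<in> U" for U
    using x that by (auto simp: limitin_def)
  have L: "closedin X L" and l: "l \<in> topspace X"
    using R x by (auto simp: limitin_def topspace_vietoris)
  have evC: "eventually (\<lambda>n. closedin X (R n)) F"
    using evR[of "topspace X"] closedin_subset[OF L] by (auto elim: eventually_mono)
  show ?thesis
    unfolding vietoris_def
  proof (rule limitin_topology_generated_by)
    show "insert l L \<in> \<Union>({{F. closedin X F \<and> F \<subseteq> U} |U. openin X U} \<union>
        {{F. closedin X F \<and> F \<inter> U \<noteq> {}} |U. openin X U})"
    proof (rule UnionI)
      show "{F. closedin X F \<and> F \<subseteq> topspace X} \<in> {{F. closedin X F \<and> F \<subseteq> U} |U. openin X U} \<union>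
        {{F. closedin X F \<and> F \<inter> U \<noteq> {}} |U. openin X U}" using openin_topspace by blast
    qed (use ins[OF l L] closedin_subset in auto)
  next
    fix V
    assume V: "V \<in> {{F. closedin X F \<and> F \<subseteq> U} |U. openin X U} \<union>
        {{F. closedin X F \<and> F \<inter> U \<noteq> {}} |U. openin X U}" and inV: "insert l L \<in> V"
    from V consider U where "openin X U" "V = {F. closedin X F \<and> F \<subseteq> U}"
      | U where "openin X U" "V = {F. closedin X F \<and> F \<inter> U \<noteq> {}}" by blast
    then show "eventually (\<lambda>n. insert (x n) (R n) \<in> V) F"
    proof cases
      case 1
      with inV have "L \<subseteq> U" "l \<in> U" by auto
      from evR[OF 1(1) this(1)] evx[OF 1(1) this(2)] show ?thesis
        by eventually_elim (use 1 ins xX in auto)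
    next
      case 2
      show ?thesis
      proof (cases "l \<in> U")
        case True
        from evC evx[OF 2(1) this] show ?thesis
          by eventually_elim (use 2 ins xX in auto)
      next
        case False
        with inV 2 have "L \<inter> U \<noteq> {}" by auto
        from evH[OF 2(1) this] show ?thesis
          by eventually_elim (use 2 ins xX in auto)
      qed
    qed
  qed
qed

lemma topspace_sym_product:
  assumes "t1_space X"
  shows "topspace (sym_product m X) = {F. F \<subseteq> topspace X \<and> F \<noteq> {} \<and> finite F \<and> card F \<le> m}"
  using assms by (auto simp: sym_product_def topspace_vietoris t1_space_closedin_finite)

text \<open>Combined with the next lemma: for clopen \<open>W\<close>, whether a set meets
  \<open>W\<close> is locally constant on the symmetric product.\<close>

lemma openin_sym_product_hit:
  assumes "t1_space X" "openin X U"
  shows "openin (sym_product m X) {F \<in> topspace (sym_product m X). F \<inter> U \<noteq> {}}"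
proof -
  have "{F \<in> topspace (sym_product m X). F \<inter> U \<noteq> {}} =
      {F. closedin X F \<and> F \<inter> U \<noteq> {}} \<inter>
      {F. F \<subseteq> topspace X \<and> F \<noteq> {} \<and> finite F \<and> card F \<le> m}"
    using assms(1) by (auto simp: topspace_sym_product t1_space_closedin_finite)
  then show ?thesis
    unfolding sym_product_def openin_subtopology using openin_vietoris_hit[OF assms(2)] by auto
qed

lemma openin_sym_product_miss:
  assumes "t1_space X" "closedin X W"
  shows "openin (sym_product m X) {F \<in> topspace (sym_product m X). F \<inter> W = {}}"
proof -
  have "{F \<in> topspace (sym_product m X). F \<inter> W = {}} =
      {F. closedin X F \<and> F \<subseteq> topspace X - W} \<inter>
      {F. F \<subseteq> topspace X \<and> F \<noteq> {} \<and> finite F \<and> card F \<le> m}"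
    using assms(1) by (auto simp: topspace_sym_product t1_space_closedin_finite)
  then show ?thesis
    unfolding sym_product_def openin_subtopology
    using openin_vietoris_subset[of X "topspace X - W"] assms(2) by auto
qed

section \<open>The double arrow space\<close>

lemma double_arrow_set_iff:
  "(a, i) \<in> double_arrow_set \<longleftrightarrow> 0 < a \<and> a \<le> 1 \<and> i = 0 \<or> 0 \<le> a \<and> a < 1 \<and> i = 1"
  by (auto simp: double_arrow_set_def)

lemma double_arrow_setD:
  assumes "p \<in> double_arrow_set"
  shows "snd p = 0 \<or> snd p = 1" "0 \<le> fst p" "fst p \<le> 1"
  using assms by (auto simp: double_arrow_set_def)

lemma topspace_double_arrow: "topspace double_arrow = double_arrow_set"
  unfolding double_arrow_def order_topology_on_def topology_generated_by_topspace by auto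

lemma openin_double_arrow_lower:
  "a \<in> double_arrow_set \<Longrightarrow> openin double_arrow {x \<in> double_arrow_set. lex_less x a}"
  unfolding double_arrow_def order_topology_on_def by (rule topology_generated_by_Basis) blast

lemma openin_double_arrow_upper:
  "a \<in> double_arrow_set \<Longrightarrow> openin double_arrow {x \<in> double_arrow_set. lex_less a x}"
  unfolding double_arrow_def order_topology_on_def by (rule topology_generated_by_Basis) blast

lemma openin_double_arrow_set: "openin double_arrow double_arrow_set"
  by (metis openin_topspace topspace_double_arrow)

lemma t1_space_double_arrow: "t1_space double_arrow"
  unfolding t1_space_closedin_singleton
proof
  fix p assume "p \<in> topspace double_arrow"
  then have p: "p \<in> double_arrow_set" by (simp add: topspace_double_arrow)
  have "double_arrow_set - {p} =
      {x \<in> double_arrow_set. lex_less x p} \<union> {x \<in> double_arrow_set. lex_less p x}"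
    by (auto simp: lex_less_def prod_eq_iff)
  then have "openin double_arrow (double_arrow_set - {p})"
    using openin_double_arrow_lower[OF p] openin_double_arrow_upper[OF p] by auto
  then show "closedin double_arrow {p}"
    using p by (simp add: closedin_def topspace_double_arrow)
qed

text \<open>Second coordinates are irrelevant here: a lower ray around \<open>(t, 0)\<close>
  contains every point strictly left of \<open>t\<close>, and an upper ray around it must start over
  some real strictly below \<open>t\<close>.\<close>

lemma limitin_double_arrow_from_left:
  assumes x: "\<And>n. x n \<in> double_arrow_set" and lt: "\<And>n. fst (x n) < t"
    and lim: "(\<lambda>n. fst (x n)) \<longlonglongrightarrow> t" and t: "t \<le> 1"
  shows "limitin double_arrow x (t, 0) sequentially"
  unfolding double_arrow_def order_topology_on_def
proof (rule limitin_topology_generated_by)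
  have "0 < t" using lt[of 0] double_arrow_setD(2)[OF x[of 0]] by simp
  then have tA: "(t, 0) \<in> double_arrow_set" using t by (simp add: double_arrow_set_iff)
  then show "(t, 0) \<in> \<Union>(insert double_arrow_set ({{x \<in> double_arrow_set. lex_less x a} |a. a \<in> double_arrow_set} \<union>
     {{x \<in> double_arrow_set. lex_less a x} |a. a \<in> double_arrow_set}))" by blast
  fix U
  assume U: "U \<in> insert double_arrow_set ({{x \<in> double_arrow_set. lex_less x a} |a. a \<in> double_arrow_set} \<union>
     {{x \<in> double_arrow_set. lex_less a x} |a. a \<in> double_arrow_set})" and tU: "(t, 0) \<in> U"
  from U consider "U = double_arrow_set"
    | a where "a \<in> double_arrow_set" "U = {x \<in> double_arrow_set. lex_less x a}"
    | a where "a \<in> double_arrow_set" "U = {x \<in> double_arrow_set. lex_less a x}" by blast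
  then show "\<forall>\<^sub>F n in sequentially. x n \<in> U"
  proof cases
    case 1
    then show ?thesis using x by simp
  next
    case 2
    then have "x n \<in> U" for n using tU x[of n] lt[of n] by (auto simp: lex_less_def)
    then show ?thesis by simp
  next
    case 3
    then have "fst a < t" using tU double_arrow_setD(1)[OF 3(1)] by (auto simp: lex_less_def)
    from order_tendstoD(1)[OF lim this] show ?thesis
      by eventually_elim (use 3 x in \<open>auto simp: lex_less_def\<close>)
  qed
qed

lemma limitin_double_arrow_from_right:
  assumes x: "\<And>n. x n \<in> double_arrow_set" and gt: "\<And>n. t < fst (x n)"
    and lim: "(\<lambda>n. fst (x n)) \<longlonglongrightarrow> t" and t: "0 \<le> t"
  shows "limitin double_arrow x (t, 1) sequentially"
  unfolding double_arrow_def order_topology_on_def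
proof (rule limitin_topology_generated_by)
  have "t < 1" using gt[of 0] double_arrow_setD(3)[OF x[of 0]] by simp
  then have tA: "(t, 1) \<in> double_arrow_set" using t by (simp add: double_arrow_set_iff)
  then show "(t, 1) \<in> \<Union>(insert double_arrow_set ({{x \<in> double_arrow_set. lex_less x a} |a. a \<in> double_arrow_set} \<union>
     {{x \<in> double_arrow_set. lex_less a x} |a. a \<in> double_arrow_set}))" by blast
  fix U
  assume U: "U \<in> insert double_arrow_set ({{x \<in> double_arrow_set. lex_less x a} |a. a \<in> double_arrow_set} \<union>
     {{x \<in> double_arrow_set. lex_less a x} |a. a \<in> double_arrow_set})" and tU: "(t, 1) \<in> U"
  from U consider "U = double_arrow_set"
    | a where "a \<in> double_arrow_set" "U = {x \<in> double_arrow_set. lex_less x a}"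
    | a where "a \<in> double_arrow_set" "U = {x \<in> double_arrow_set. lex_less a x}" by blast
  then show "\<forall>\<^sub>F n in sequentially. x n \<in> U"
  proof cases
    case 1
    then show ?thesis using x by simp
  next
    case 2
    then have "t < fst a" using tU double_arrow_setD(1)[OF 2(1)] by (auto simp: lex_less_def)
    from order_tendstoD(2)[OF lim this] show ?thesis
      by eventually_elim (use 2 x in \<open>auto simp: lex_less_def\<close>)
  next
    case 3
    then have "x n \<in> U" for n using tU x[of n] gt[of n] by (auto simp: lex_less_def)
    then show ?thesis by simp
  qed
qed

section \<open>Sequential compactness\<close>

lemma double_arrow_convergent_subsequence:
  assumes x: "\<And>n. x n \<in> double_arrow_set"
  obtains r l where "strict_mono (r :: nat \<Rightarrow> nat)" "l \<in> double_arrow_set"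
    "limitin double_arrow (\<lambda>n. x (r n)) l sequentially"
proof -
  have "fst (x n) \<in> {0..1}" for n using double_arrow_setD[OF x[of n]] by simp
  then obtain r t where r: "strict_mono r" and t: "t \<in> {0..1}"
    and lim: "(\<lambda>n. fst (x (r n))) \<longlonglongrightarrow> t"
    and alt: "(\<forall>n. fst (x (r n)) < t) \<or> (\<forall>n. t < fst (x (r n))) \<or> (\<forall>n. fst (x (r n)) = t)"
    by (rule one_sided_convergent_subsequence)
  consider (left) "\<forall>n. fst (x (r n)) < t" | (right) "\<forall>n. t < fst (x (r n))" | (const) "\<forall>n. fst (x (r n)) = t"
    using alt by blast
  then show ?thesis
  proof cases
    case left
    then have "limitin double_arrow (\<lambda>n. x (r n)) (t, 0) sequentially"
      using limitin_double_arrow_from_left[of "\<lambda>n. x (r n)" t] x lim t by simp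
    then show ?thesis using that r by (metis limitin_topspace topspace_double_arrow)
  next
    case right
    then have "limitin double_arrow (\<lambda>n. x (r n)) (t, 1) sequentially"
      using limitin_double_arrow_from_right[of "\<lambda>n. x (r n)" t] x lim t by simp
    then show ?thesis using that r by (metis limitin_topspace topspace_double_arrow)
  next
    case const
    \<comment> \<open>The fibre over \<open>t\<close> has at most two points, so one of them is
      taken infinitely often.\<close>
    have "{n. x (r n) = (t, 0)} \<union> {n. x (r n) = (t, 1)} = UNIV"
      using const double_arrow_setD(1)[OF x] by (auto simp: prod_eq_iff)
    then obtain i where "infinite {n. x (r n) = (t, i)}"
      by (metis finite_Un infinite_UNIV_nat)
    then obtain q :: "nat \<Rightarrow> nat" where q: "strict_mono q" "\<And>n. x (r (q n)) = (t, i)"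
      using infinite_imp_subsequence by (metis (mono_tags) mem_Collect_eq)
    have "(t, i) \<in> double_arrow_set" using x[of "r (q 0)"] q(2) by simp
    moreover have "strict_mono (\<lambda>n. r (q n))" using strict_mono_o[OF r q(1)] by (simp add: o_def)
    ultimately show ?thesis
      using that[of "\<lambda>n. r (q n)" "(t, i)"] q(2) by (simp add: limitin_const_iff topspace_double_arrow)
  qed
qed

lemma finite_subsets_convergent_subsequence:
  assumes "\<And>n. R n \<subseteq> double_arrow_set" "\<And>n. finite (R n)" "\<And>n. card (R n) \<le> k"
  shows "\<exists>r L. strict_mono (r :: nat \<Rightarrow> nat) \<and> L \<subseteq> double_arrow_set \<and> finite L \<and> card L \<le> k \<and>
    limitin (vietoris double_arrow) (\<lambda>n. R (r n)) L sequentially"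
  using assms
proof (induction k arbitrary: R)
  case 0
  then have "R n = {}" for n by simp
  then show ?case
    by (intro exI[of _ id] exI[of _ "{}"]) (simp add: strict_mono_def topspace_vietoris)
next
  case (Suc k)
  show ?case
  proof (cases "finite {n. R n \<noteq> {}}")
    case True
    have "{n. R n = {}} \<union> {n. R n \<noteq> {}} = UNIV" by auto
    with True have "infinite {n. R n = {}}" by (metis finite_Un infinite_UNIV_nat)
    then obtain r :: "nat \<Rightarrow> nat" where "strict_mono r" "\<And>n. R (r n) = {}" 
      using infinite_imp_subsequence by (metis (mono_tags) mem_Collect_eq)
    then show ?thesis
      by (intro exI[of _ r] exI[of _ "{}"]) (simp add: topspace_vietoris)
  next
    case False
    then obtain r0 :: "nat \<Rightarrow> nat" where r0: "strict_mono r0" "\<And>n. R (r0 n) \<noteq> {}"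
      using infinite_imp_subsequence by (metis (mono_tags) mem_Collect_eq)
    define x where "x n = (SOME y. y \<in> R (r0 n))" for n
    have x: "x n \<in> R (r0 n)" for n using r0(2) by (simp add: x_def some_in_eq)
    then have xA: "x n \<in> double_arrow_set" for n using Suc.prems(1) by blast
    then obtain r1 l where r1: "strict_mono r1" "l \<in> double_arrow_set"
      and lim1: "limitin double_arrow (\<lambda>n. x (r1 n)) l sequentially"
      by (rule double_arrow_convergent_subsequence)
    define R' where "R' n = R (r0 (r1 n)) - {x (r1 n)}" for n
    have "card (R' n) \<le> k" for n
      using Suc.prems(2,3)[of "r0 (r1 n)"] x[of "r1 n"] by (simp add: R'_def)
    moreover have "R' n \<subseteq> double_arrow_set" "finite (R' n)" for n
      using Suc.prems(1,2) by (auto simp: R'_def)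
    ultimately obtain r2 L where r2: "strict_mono r2" and L: "L \<subseteq> double_arrow_set" "finite L" "card L \<le> k"
      and lim2: "limitin (vietoris double_arrow) (\<lambda>n. R' (r2 n)) L sequentially"
      using Suc.IH[of R'] by blast
    let ?r = "\<lambda>n. r0 (r1 (r2 n))"
    have "limitin (vietoris double_arrow) (\<lambda>n. insert (x (r1 (r2 n))) (R' (r2 n))) (insert l L) sequentially"
      using t1_space_double_arrow lim2 limitin_subseq[OF lim1 r2]
      by (rule limitin_vietoris_insert) (simp add: topspace_double_arrow xA)
    moreover have "insert (x (r1 (r2 n))) (R' (r2 n)) = R (?r n)" for n
      using x by (auto simp: R'_def)
    moreover have "strict_mono ?r"
      using r0(1) r1(1) r2 by (simp add: strict_mono_def)
    moreover have "card (insert l L) \<le> Suc k"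
      using L by (simp add: card_insert_if)
    ultimately show ?thesis
      using L r1(2) by (intro exI[of _ ?r] exI[of _ "insert l L"]) simp
  qed
qed

text \<open>Both choices of the second coordinate share the subsequence and the limit
  \<open>p\<close>; this makes the swap invisible in the limit.\<close>

lemma double_arrow_pairs_convergent:
  assumes "inj b" "\<And>n. 0 < b n \<and> b n < 1"
  obtains r p where "strict_mono (r :: nat \<Rightarrow> nat)" "p \<in> double_arrow_set"
    "\<And>i. i \<in> {0, 1} \<Longrightarrow> limitin double_arrow (\<lambda>n. (b (r n), i)) p sequentially"
proof -
  have "b n \<in> {0..1}" for n using assms(2)[of n] by simp
  then obtain r t where r: "strict_mono r" and t: "t \<in> {0..1}" and lim: "(\<lambda>n. b (r n)) \<longlonglongrightarrow> t"
    and alt: "(\<forall>n. b (r n) < t) \<or> (\<forall>n. t < b (r n)) \<or> (\<forall>n. b (r n) = t)"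
    by (rule one_sided_convergent_subsequence)
  have A: "(b (r n), i) \<in> double_arrow_set" if "i \<in> {0, 1}" for n i
    using that assms(2)[of "r n"] by (auto simp: double_arrow_set_iff)
  \<comment> \<open>Injectivity of \<open>b\<close> rules out the constant case, the only one in
    which the two limits would differ.\<close>
  have "\<not> (\<forall>n. b (r n) = t)"
  proof
    assume "\<forall>n. b (r n) = t"
    then have "r 0 = r 1" using assms(1) by (metis injD)
    then show False using r by (metis strict_mono_eq zero_neq_one)
  qed
  then consider "\<forall>n. b (r n) < t" | "\<forall>n. t < b (r n)" using alt by blast
  then have "\<exists>j. \<forall>i\<in>{0, 1}. limitin double_arrow (\<lambda>n. (b (r n), i)) (t, j) sequentially"
  proof cases
    case 1
    show ?thesis
      by (intro exI[of _ 0] ballI limitin_double_arrow_from_left) (use A 1 lim t in auto)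
  next
    case 2
    show ?thesis
      by (intro exI[of _ 1] ballI limitin_double_arrow_from_right) (use A 2 lim t in auto)
  qed
  then obtain j where j: "\<And>i. i \<in> {0, 1} \<Longrightarrow> limitin double_arrow (\<lambda>n. (b (r n), i)) (t, j) sequentially"
    by blast
  then have "(t, j) \<in> double_arrow_set" by (metis insertI1 limitin_topspace topspace_double_arrow)
  with r j show ?thesis using that by blast
qed

section \<open>Clopen intervals\<close>

text \<open>The final segment that begins in the jump between the adjacent points
  \<open>(q, 0)\<close> and \<open>(q, 1)\<close>, hence clopen. Values of \<open>q\<close> outside
  the unit interval give the whole space or the empty set.\<close>

definition upper_cut :: "real \<Rightarrow> (real \<times> real) set" where
  "upper_cut q = {p \<in> double_arrow_set. q < fst p \<or> p = (q, 1)}"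

lemma openin_upper_cut: "openin double_arrow (upper_cut q)"
proof -
  consider "q \<le> 0" | "0 < q" "q \<le> 1" | "1 < q" by linarith
  then show ?thesis
  proof cases
    case 1
    then have "upper_cut q = double_arrow_set"
      by (auto simp: upper_cut_def double_arrow_set_def)
    then show ?thesis by (simp add: openin_double_arrow_set)
  next
    case 2
    then have "upper_cut q = {x \<in> double_arrow_set. lex_less (q, 0) x}"
      by (auto simp: upper_cut_def double_arrow_set_def lex_less_def)
    then show ?thesis using openin_double_arrow_upper[of "(q, 0)"] 2 by (simp add: double_arrow_set_iff)
  next
    case 3
    then have "upper_cut q = {}"
      by (auto simp: upper_cut_def double_arrow_set_def)
    then show ?thesis by simp
  qed
qed

lemma closedin_upper_cut: "closedin double_arrow (upper_cut q)"
proof -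
  have "openin double_arrow (double_arrow_set - upper_cut q)"
  proof -
    consider "q < 0" | "0 \<le> q" "q < 1" | "1 \<le> q" by linarith
    then show ?thesis
    proof cases
      case 1
      then have "double_arrow_set - upper_cut q = {}"
        by (auto simp: upper_cut_def double_arrow_set_def)
      then show ?thesis by (simp only: openin_empty)
    next
      case 2
      then have "double_arrow_set - upper_cut q = {x \<in> double_arrow_set. lex_less x (q, 1)}"
        by (auto simp: upper_cut_def double_arrow_set_def lex_less_def)
      then show ?thesis using openin_double_arrow_lower[of "(q, 1)"] 2 by (simp add: double_arrow_set_iff)
    next
      case 3
      then have "double_arrow_set - upper_cut q = double_arrow_set"
        by (auto simp: upper_cut_def double_arrow_set_def)
      then show ?thesis by (simp add: openin_double_arrow_set)
    qed
  qed
  then show ?thesis by (auto simp: closedin_def topspace_double_arrow upper_cut_def)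
qed

text \<open>For \<open>q < q'\<close> this is the closed order interval from \<open>(q, 1)\<close>
  to \<open>(q', 0)\<close>, as far as it lies in the space.\<close>

definition clopen_interval :: "real \<Rightarrow> real \<Rightarrow> (real \<times> real) set" where
  "clopen_interval q q' = upper_cut q - upper_cut q'"

lemma openin_clopen_interval: "openin double_arrow (clopen_interval q q')"
  by (simp add: clopen_interval_def openin_diff openin_upper_cut closedin_upper_cut)

lemma closedin_clopen_interval: "closedin double_arrow (clopen_interval q q')"
  by (simp add: clopen_interval_def closedin_diff openin_upper_cut closedin_upper_cut)

lemma mem_clopen_interval:
  "p \<in> clopen_interval q q' \<longleftrightarrow>
    p \<in> double_arrow_set \<and> (q < fst p \<or> p = (q, 1)) \<and> (fst p < q' \<or> fst p = q' \<and> snd p = 0)"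
  by (cases p) (auto simp: clopen_interval_def upper_cut_def double_arrow_set_iff)


section \<open>The exceptional parameters of a continuous map\<close>

text \<open>The bound \<open>card R < m\<close> keeps the enlarged sets inside the symmetric
  product. \<open>R\<close> may itself contain a point over \<open>b\<close>, so a singleton can
  also be compared with the full fibre.\<close>

definition splitting_set :: "nat \<Rightarrow> ((real \<times> real) set \<Rightarrow> (real \<times> real) set) \<Rightarrow> (real \<times> real) set \<Rightarrow> real set" where
  "splitting_set m f W = {b. 0 < b \<and> b < 1 \<and> (\<exists>R. R \<subseteq> double_arrow_set \<and> finite R \<and> card R < m \<and>
     (f (insert (b, 0) R) \<inter> W = {}) \<noteq> (f (insert (b, 1) R) \<inter> W = {}))}"

lemma finite_splitting_set:
  assumes f: "continuous_map (sym_product m double_arrow) (sym_product m double_arrow) f"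
    and W: "openin double_arrow W" "closedin double_arrow W"
  shows "finite (splitting_set m f W)"
proof (rule ccontr)
  let ?Y = "sym_product m double_arrow"
  assume "infinite (splitting_set m f W)"
  then obtain b :: "nat \<Rightarrow> real" where b: "inj b" "range b \<subseteq> splitting_set m f W"
    using infinite_countable_subset by blast
  then have "\<forall>n. 0 < b n \<and> b n < 1 \<and> (\<exists>R. R \<subseteq> double_arrow_set \<and> finite R \<and> card R < m \<and>
     (f (insert (b n, 0) R) \<inter> W = {}) \<noteq> (f (insert (b n, 1) R) \<inter> W = {}))"
    unfolding splitting_set_def by blast
  then obtain R where b01: "\<And>n. 0 < b n \<and> b n < 1"
    and R: "\<And>n. R n \<subseteq> double_arrow_set" "\<And>n. finite (R n)" "\<And>n. card (R n) < m"
    and split: "\<And>n. (f (insert (b n, 0) (R n)) \<inter> W = {}) \<noteq> (f (insert (b n, 1) (R n)) \<inter> W = {})"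
    by metis
  obtain r p where r: "strict_mono r" and p: "p \<in> double_arrow_set"
    and limb: "\<And>i. i \<in> {0, 1} \<Longrightarrow> limitin double_arrow (\<lambda>n. (b (r n), i)) p sequentially"
    using double_arrow_pairs_convergent[OF b(1) b01] by blast
  \<comment> \<open>With \<open>m\<close> positive, \<open>m - 1\<close> is a true predecessor, so
    the limit \<open>L\<close> leaves room for the additional point \<open>p\<close>.\<close>
  have m: "0 < m" using R(3)[of 0] by simp
  have "card (R (r n)) \<le> m - 1" for n using R(3)[of "r n"] by simp
  then obtain s L where s: "strict_mono s" and L: "L \<subseteq> double_arrow_set" "finite L" "card L \<le> m - 1"
    and limR: "limitin (vietoris double_arrow) (\<lambda>n. R (r (s n))) L sequentially"
    using finite_subsets_convergent_subsequence[of "\<lambda>n. R (r n)" "m - 1"] R by blast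
  define G where "G i n = insert (b (r (s n)), i) (R (r (s n)))" for i n
  have A: "(b n, i) \<in> double_arrow_set" if "i \<in> {0, 1}" for n i
    using that b01[of n] by (auto simp: double_arrow_set_iff)
  have GY: "G i n \<in> topspace ?Y" if "i \<in> {0, 1}" for i n
    using A[OF that] R(1,2)[of "r (s n)"] R(3)[of "r (s n)"]
    by (auto simp: G_def topspace_sym_product[OF t1_space_double_arrow] topspace_double_arrow card_insert_if)
  have lim: "limitin ?Y (f \<circ> G i) (f (insert p L)) sequentially" if i: "i \<in> {0, 1}" for i
  proof -
    have "limitin (vietoris double_arrow) (G i) (insert p L) sequentially"
      unfolding G_def
      using t1_space_double_arrow limR limitin_subseq[OF limb[OF i] s]
      by (rule limitin_vietoris_insert) (simp add: topspace_double_arrow A[OF i])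
    moreover have "card (insert p L) \<le> m" using L m card_insert_le_m1[of m L p] by simp
    moreover have "G i n \<subseteq> double_arrow_set \<and> G i n \<noteq> {} \<and> finite (G i n) \<and> card (G i n) \<le> m" for n
      using GY[OF i, of n] by (simp add: topspace_sym_product[OF t1_space_double_arrow] topspace_double_arrow)
    ultimately have "limitin ?Y (G i) (insert p L) sequentially"
      using L p by (simp add: sym_product_def limitin_subtopology topspace_double_arrow)
    then show ?thesis by (rule continuous_map_limit[OF f])
  qed
  \<comment> \<open>Both image sequences converge to \<open>f (insert p L)\<close>, so eventually
    they share its truth value \<open>c\<close> for missing \<open>W\<close>, against the choice of
    \<open>b\<close> and \<open>R\<close>.\<close>
  have "\<exists>c. \<forall>i\<in>{0, 1}. \<forall>\<^sub>F n in sequentially. (f (G i n) \<inter> W = {}) = c"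
  proof (cases "f (insert p L) \<inter> W = {}")
    case True
    have "\<forall>\<^sub>F n in sequentially. f (G i n) \<inter> W = {}" if "i \<in> {0, 1}" for i
    proof -
      have "\<forall>\<^sub>F n in sequentially. f (G i n) \<in> {F \<in> topspace ?Y. F \<inter> W = {}}"
        using eventually_limitin[OF lim[OF that] openin_sym_product_miss[OF t1_space_double_arrow W(2)]]
          True limitin_topspace[OF lim[OF that]] by simp
      then show ?thesis by (rule eventually_mono) blast
    qed
    then show ?thesis by (intro exI[of _ True]) simp
  next
    case False
    have "\<forall>\<^sub>F n in sequentially. f (G i n) \<inter> W \<noteq> {}" if "i \<in> {0, 1}" for i
    proof -
      have "\<forall>\<^sub>F n in sequentially. f (G i n) \<in> {F \<in> topspace ?Y. F \<inter> W \<noteq> {}}"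
        using eventually_limitin[OF lim[OF that] openin_sym_product_hit[OF t1_space_double_arrow W(1)]]
          False limitin_topspace[OF lim[OF that]] by simp
      then show ?thesis by (rule eventually_mono) blast
    qed
    then show ?thesis by (intro exI[of _ False]) simp
  qed
  then obtain c where "\<forall>\<^sub>F n in sequentially. (f (G 0 n) \<inter> W = {}) = c"
    "\<forall>\<^sub>F n in sequentially. (f (G 1 n) \<inter> W = {}) = c" by auto
  then have "\<forall>\<^sub>F n in sequentially. False"
    by eventually_elim (use split in \<open>auto simp: G_def\<close>)
  then show False by simp
qed

text \<open>\<open>T\<close> is the set of admissible interval endpoints. A countable
  \<open>T\<close> yields countably many intervals, each with a finite splitting set when
  \<open>f\<close> is continuous.\<close>

definition exceptional_set :: "nat \<Rightarrow> ((real \<times> real) set \<Rightarrow> (real \<times> real) set) \<Rightarrow> real set \<Rightarrow> real set" where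
  "exceptional_set m f T = (\<Union>q\<in>T. \<Union>q'\<in>T. splitting_set m f (clopen_interval q q'))"

lemma countable_exceptional_set:
  assumes "continuous_map (sym_product m double_arrow) (sym_product m double_arrow) f" "countable T"
  shows "countable (exceptional_set m f T)"
  unfolding exceptional_set_def
  using assms(2) finite_splitting_set[OF assms(1) openin_clopen_interval closedin_clopen_interval]
  by (intro countable_UN) (auto intro: countable_finite)

section \<open>Separating points by intervals with prescribed endpoints\<close>

lemma finite_gap_left:
  fixes t :: real
  assumes "finite B"
  obtains q where "q \<in> \<rat>" "q < t" "\<And>x. x \<in> B \<Longrightarrow> q \<le> x \<Longrightarrow> t \<le> x"
proof -
  \<comment> \<open>\<open>e\<close> is the distance from \<open>t\<close> to the nearest point of
    \<open>B\<close> on its left, or 1 if there is none.\<close>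
  obtain e where e: "e > 0" "\<And>x. x \<in> B \<Longrightarrow> x < t \<Longrightarrow> e \<le> t - x"
  proof (cases "{x \<in> B. x < t} = {}")
    case True
    then show ?thesis using that[of 1] by auto
  next
    case False
    with assms have "t - Max {x \<in> B. x < t} > 0" by (subst diff_gt_0_iff_gt, subst Max_less_iff) auto
    moreover have "t - Max {x \<in> B. x < t} \<le> t - x" if "x \<in> B" "x < t" for x
      using assms that by (auto intro: Max_ge)
    ultimately show ?thesis using that by blast
  qed
  obtain q where "q \<in> \<rat>" "t - e < q" "q < t"
    using Rats_dense_in_real[of "t - e" t] e(1) by auto
  then show ?thesis using that[of q] e(2) by force
qed

lemma finite_gap_right:
  fixes t :: real
  assumes "finite B"
  obtains q where "q \<in> \<rat>" "t < q" "\<And>x. x \<in> B \<Longrightarrow> x \<le> q \<Longrightarrow> x \<le> t"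
proof -
  obtain q where q: "q \<in> \<rat>" "q < - t" "\<And>x. x \<in> uminus ` B \<Longrightarrow> q \<le> x \<Longrightarrow> - t \<le> x"
    using finite_gap_left[of "uminus ` B" "- t"] assms by auto
  show ?thesis
  proof (rule that[of "- q"])
    show "x \<le> t" if "x \<in> B" "x \<le> - q" for x using q(3)[of "- x"] that by simp
  qed (use q in auto)
qed

text \<open>Rational endpoints close to \<open>fst p\<close> exclude all of \<open>F'\<close> except
  points over \<open>fst p\<close> itself. If \<open>fst p\<close> lies in \<open>T\<close>, it can
  serve as an endpoint, which cuts \<open>p\<close> off from the other point of its fibre; otherwise
  \<open>F'\<close> has no point in that fibre by assumption.\<close>

lemma clopen_intervals_separate:
  assumes F': "F' \<subseteq> double_arrow_set" "finite F'" and p: "p \<in> double_arrow_set" and T: "\<rat> \<subseteq> T"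
    and not: "p \<notin> F'" "fst p \<notin> T \<Longrightarrow> fst p \<notin> fst ` F'"
  obtains q q' where "q \<in> T" "q' \<in> T" "p \<in> clopen_interval q q'" "F' \<inter> clopen_interval q q' = {}"
proof -
  define t where "t = fst p"
  obtain q where q: "q \<in> \<rat>" "q < t" "\<And>x. x \<in> fst ` F' \<Longrightarrow> q \<le> x \<Longrightarrow> t \<le> x"
    using finite_gap_left[of "fst ` F'" t] F' by blast
  obtain q' where q': "q' \<in> \<rat>" "t < q'" "\<And>x. x \<in> fst ` F' \<Longrightarrow> x \<le> q' \<Longrightarrow> x \<le> t"
    using finite_gap_right[of "fst ` F'" t] F' by blast
  have qT: "q \<in> T" "q' \<in> T" using q q' T by auto
  have fstx: "fst x = t" if "x \<in> F'" "q \<le> fst x" "fst x \<le> q'" for x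
    using q(3)[of "fst x"] q'(3)[of "fst x"] that by force
  consider "t \<notin> T" | "t \<in> T" "snd p = 0" | "t \<in> T" "snd p = 1"
    using double_arrow_setD(1)[OF p] by blast
  then show ?thesis
  proof cases
    case 1
    then have "t \<notin> fst ` F'" using not(2) t_def by simp
    then have "F' \<inter> clopen_interval q q' = {}"
      using fstx by (force simp: mem_clopen_interval)
    moreover have "p \<in> clopen_interval q q'" using p q q' by (simp add: mem_clopen_interval t_def)
    ultimately show ?thesis using that qT by blast
  next
    case 2
    have "x \<notin> clopen_interval q t" if "x \<in> F'" for x
    proof
      assume "x \<in> clopen_interval q t"
      then have "q \<le> fst x" "fst x \<le> t" "fst x = t \<Longrightarrow> snd x = 0" by (auto simp: mem_clopen_interval)
      then have "x = p" using fstx[OF that] q' 2 by (auto simp: prod_eq_iff t_def)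
      then show False using that not(1) by simp
    qed
    moreover have "p \<in> clopen_interval q t" using p q 2 by (simp add: mem_clopen_interval t_def)
    ultimately show ?thesis using that[of q t] qT 2 by blast
  next
    case 3
    have "x \<notin> clopen_interval t q'" if "x \<in> F'" for x
    proof
      assume "x \<in> clopen_interval t q'"
      then have "t \<le> fst x" "fst x \<le> q'" "fst x = t \<Longrightarrow> snd x = 1" by (auto simp: mem_clopen_interval)
      then have "x = p" using fstx[OF that] q 3 by (auto simp: prod_eq_iff t_def)
      then show False using that not(1) by simp
    qed
    moreover have "p \<in> clopen_interval t q'"
      using p q' 3 by (simp add: mem_clopen_interval t_def prod_eq_iff)
    ultimately show ?thesis using that[of t q'] qT 3 by blast
  qed
qed

text \<open>The two images meet the same clopen intervals with endpoints in \<open>T\<close>. By the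
  separation lemma these intervals detect the projection everywhere, and the exact point over
  \<open>T\<close>.\<close>

lemma swap_unexceptional:
  assumes f: "continuous_map (sym_product m double_arrow) (sym_product m double_arrow) f"
    and T: "\<rat> \<subseteq> T" and b: "0 < b" "b < 1" "b \<notin> exceptional_set m f T"
    and R: "R \<subseteq> double_arrow_set" "finite R" "card R < m" and ij: "i \<in> {0, 1}" "j \<in> {0, 1}"
  shows "fst ` f (insert (b, i) R) = fst ` f (insert (b, j) R)"
    and "fst p \<in> T \<Longrightarrow> p \<in> f (insert (b, i) R) \<longleftrightarrow> p \<in> f (insert (b, j) R)"
proof -
  define G where "G k = f (insert (b, k) R)" for k :: real
  have G: "G k \<subseteq> double_arrow_set" "finite (G k)" if "k \<in> {0, 1}" for k
  proof -
    have "insert (b, k) R \<in> topspace (sym_product m double_arrow)"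
      using R b that
      by (auto simp: topspace_sym_product[OF t1_space_double_arrow] topspace_double_arrow
          double_arrow_set_iff card_insert_if)
    then have "G k \<in> topspace (sym_product m double_arrow)"
      using continuous_map_image_subset_topspace[OF f] by (auto simp: G_def)
    then show "G k \<subseteq> double_arrow_set" "finite (G k)"
      by (auto simp: topspace_sym_product[OF t1_space_double_arrow] topspace_double_arrow)
  qed
  have eq01: "(G 0 \<inter> clopen_interval q q' = {}) = (G 1 \<inter> clopen_interval q q' = {})"
    if "q \<in> T" "q' \<in> T" for q q'
  proof -
    have "b \<notin> splitting_set m f (clopen_interval q q')"
      using b(3) that by (auto simp: exceptional_set_def)
    then show ?thesis using b R unfolding splitting_set_def G_def by blast
  qed
  have eq: "(G k \<inter> clopen_interval q q' = {}) = (G l \<inter> clopen_interval q q' = {})"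
    if "q \<in> T" "q' \<in> T" "k \<in> {0, 1}" "l \<in> {0, 1}" for q q' k l
    using eq01[OF that(1,2)] that(3,4) by auto
  \<comment> \<open>A point \<open>p\<close> without a counterpart in \<open>G l\<close> would lie
    in an interval that \<open>G l\<close> misses and \<open>G k\<close> meets.\<close>
  have sub: "p \<in> G l \<or> fst p \<notin> T \<and> fst p \<in> fst ` G l"
    if pk: "p \<in> G k" and k: "k \<in> {0, 1}" and l: "l \<in> {0, 1}" for p k l
  proof (rule ccontr)
    assume "\<not> (p \<in> G l \<or> fst p \<notin> T \<and> fst p \<in> fst ` G l)"
    then have not: "p \<notin> G l" "fst p \<notin> T \<Longrightarrow> fst p \<notin> fst ` G l" by simp_all
    have "p \<in> double_arrow_set" using G(1)[OF k] pk by (rule subsetD)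
    then obtain q q' where "q \<in> T" "q' \<in> T" "p \<in> clopen_interval q q'" "G l \<inter> clopen_interval q q' = {}"
      using clopen_intervals_separate[OF G[OF l] _ T not] by metis
    then show False using eq[of q q' k l] pk k l by blast
  qed
  have "fst ` G k \<subseteq> fst ` G l" if "k \<in> {0, 1}" "l \<in> {0, 1}" for k l
  proof
    fix t assume "t \<in> fst ` G k"
    then obtain x where "x \<in> G k" "t = fst x" by blast
    then show "t \<in> fst ` G l" using sub[OF \<open>x \<in> G k\<close> that] by blast
  qed
  then show "fst ` f (insert (b, i) R) = fst ` f (insert (b, j) R)"
    using ij unfolding G_def by (intro antisym)
  show "p \<in> f (insert (b, i) R) \<longleftrightarrow> p \<in> f (insert (b, j) R)" if "fst p \<in> T"
    using sub[of p i j] sub[of p j i] ij that unfolding G_def by blast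
qed

section \<open>Non-homogeneity\<close>

text \<open>Require a set to meet \<open>m\<close> bands with disjoint projections. Having at most
  \<open>m\<close> points, it then has exactly \<open>m\<close> projections.\<close>

lemma open_full_projection:
  assumes m: "0 < m"
  obtains U where "openin (sym_product m double_arrow) U" "U \<noteq> {}" "\<And>G. G \<in> U \<Longrightarrow> card (fst ` G) = m"
proof -
  let ?Y = "sym_product m double_arrow"
  \<comment> \<open>Each band covers only the first half of its cell of length \<open>1 / m\<close>,
    so bands do not touch and \<open>\<lfloor>x * real m\<rfloor>\<close> recovers the index
    \<open>k\<close>. The right ends of the bands form the sample member \<open>Q\<close>.\<close>
  define W where "W k = clopen_interval (real k / real m) ((real k + 1 / 2) / real m)" for k
  define U where "U = (\<Inter>k\<in>{..<m}. {G \<in> topspace ?Y. G \<inter> W k \<noteq> {}})"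
  define Q where "Q = (\<lambda>k. ((real k + 1 / 2) / real m, 0 :: real)) ` {..<m}"
  show ?thesis
  proof
    show "openin ?Y U"
      unfolding U_def
      by (rule openin_Inter)
        (use m in \<open>auto simp: W_def intro!: openin_sym_product_hit t1_space_double_arrow openin_clopen_interval\<close>)
    have QA: "((real k + 1 / 2) / real m, 0) \<in> double_arrow_set" if "k < m" for k
    proof -
      have "real k + 1 \<le> real m" using that by linarith
      then show ?thesis using m by (simp add: double_arrow_set_iff field_simps)
    qed
    moreover have "card Q \<le> m" unfolding Q_def by (metis card_image_le card_lessThan finite_lessThan)
    ultimately have "Q \<in> topspace ?Y"
      using m by (auto simp: Q_def topspace_sym_product[OF t1_space_double_arrow] topspace_double_arrow)
    moreover have "((real k + 1 / 2) / real m, 0) \<in> Q \<inter> W k" if "k < m" for k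
      using QA[OF that] that m by (auto simp: Q_def W_def mem_clopen_interval divide_strict_right_mono)
    ultimately have "Q \<in> U" unfolding U_def by blast
    then show "U \<noteq> {}" by blast
    fix G assume G: "G \<in> U"
    then have "G \<in> topspace ?Y" using m by (auto simp: U_def)
    then have fin: "finite G" "card G \<le> m"
      by (auto simp: topspace_sym_product[OF t1_space_double_arrow])
    have "int k \<in> (\<lambda>x. \<lfloor>x * real m\<rfloor>) ` fst ` G" if "k < m" for k
    proof -
      have "G \<inter> W k \<noteq> {}" using G that by (simp add: U_def)
      then obtain p where p: "p \<in> G" "p \<in> W k" by blast
      then have "real k / real m \<le> fst p" "fst p \<le> (real k + 1 / 2) / real m"
        by (auto simp: W_def mem_clopen_interval)
      then have "real k \<le> fst p * real m" "fst p * real m \<le> real k + 1 / 2"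
        using m by (auto simp: field_simps)
      then have "\<lfloor>fst p * real m\<rfloor> = int k" by (simp add: floor_eq_iff)
      then show ?thesis using p(1) by force
    qed
    then have "int ` {..<m} \<subseteq> (\<lambda>x. \<lfloor>x * real m\<rfloor>) ` fst ` G" by auto
    then have "card (int ` {..<m}) \<le> card ((\<lambda>x. \<lfloor>x * real m\<rfloor>) ` fst ` G)"
      using fin by (intro card_mono) auto
    also have "\<dots> \<le> card (fst ` G)" using fin by (intro card_image_le) auto
    finally have "m \<le> card (fst ` G)" by (simp add: card_image)
    moreover have "card (fst ` G) \<le> m" using fin card_image_le[of G fst] by simp
    ultimately show "card (fst ` G) = m" by simp
  qed
qed

lemma nonempty_subset_of_fibre:
  assumes "F \<subseteq> double_arrow_set" "F \<noteq> {}" "fst ` F \<subseteq> {a}"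
  shows "F \<in> {{(a, 0)}, {(a, 1)}, {(a, 0), (a, 1)}}"
proof -
  have "F \<subseteq> {(a, 0), (a, 1)}"
  proof
    fix p assume "p \<in> F"
    then have "fst p = a" "snd p = 0 \<or> snd p = 1" using assms double_arrow_setD(1) by blast+
    then show "p \<in> {(a, 0), (a, 1)}" by (cases p) auto
  qed
  then show ?thesis using assms(2) by blast
qed

text \<open>Two distinct unexceptional projections would permit two independent swaps. The resulting
  four sets have images over the single real \<open>a\<close>, where only three nonempty sets exist,
  contrary to injectivity.\<close>

lemma unexceptional_projection_unique:
  assumes g: "continuous_map (sym_product m double_arrow) (sym_product m double_arrow) g"
    and inj: "inj_on g (topspace (sym_product m double_arrow))"
    and G: "G \<in> topspace (sym_product m double_arrow)" "card (fst ` G) = m" and a: "fst ` g G = {a}"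
    and p: "p \<in> G" "p' \<in> G"
    and b: "0 < fst p" "fst p < 1" "fst p \<notin> exceptional_set m g \<rat>"
    and b': "0 < fst p'" "fst p' < 1" "fst p' \<notin> exceptional_set m g \<rat>"
  shows "fst p = fst p'"
proof (rule ccontr)
  let ?Y = "sym_product m double_arrow"
  assume ne: "fst p \<noteq> fst p'"
  have GA: "G \<subseteq> double_arrow_set" "finite G" "card G \<le> m"
    using G(1) by (auto simp: topspace_sym_product[OF t1_space_double_arrow] topspace_double_arrow)
  have cG: "card G = m" using G(2) GA card_image_le[of G fst] by simp
  then have injG: "inj_on fst G" using G(2) GA by (simp add: inj_on_iff_eq_card)
  define R where "R = G - {p, p'}"
  have R: "R \<subseteq> double_arrow_set" "finite R" using GA by (auto simp: R_def)
  have RG: "G = insert p (insert p' R)" using p by (auto simp: R_def)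
  have "p \<noteq> p'" "p \<notin> R" "p' \<notin> R" using ne by (auto simp: R_def)
  then have cR: "card R + 2 = m" using cG R(2) RG by simp
  \<comment> \<open>Since \<open>G\<close> has as many projections as points, no other point of
    \<open>G\<close> lies over the two swapped positions. This later makes the four sets
    \<open>H i j\<close> distinct.\<close>
  have RA: "fst x \<noteq> fst p \<and> fst x \<noteq> fst p'" if "x \<in> R" for x
    using injG that p by (auto simp: R_def inj_on_def)
  define H where "H i j = insert (fst p, i) (insert (fst p', j) R)" for i j :: real
  have mem: "(fst p, i) \<in> double_arrow_set" "(fst p', i) \<in> double_arrow_set" if "i \<in> {0, 1}" for i
    using that b b' by (auto simp: double_arrow_set_iff)
  have HY: "H i j \<in> topspace ?Y" if "i \<in> {0, 1}" "j \<in> {0, 1}" for i j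
    using mem that R cR
    by (auto simp: H_def topspace_sym_product[OF t1_space_double_arrow] topspace_double_arrow card_insert_if)
  \<comment> \<open>One position is swapped while the other stays fixed; the unswapped part has at
    most \<open>m - 1\<close> points, as the swap lemma demands.\<close>
  have s1: "fst ` g (H i k) = fst ` g (H j k)" if "i \<in> {0, 1}" "j \<in> {0, 1}" "k \<in> {0, 1}" for i j k
    unfolding H_def
    by (rule swap_unexceptional(1)[OF g _ b _ _ _ that(1,2)])
      (use R cR mem that in \<open>auto simp: card_insert_if\<close>)
  have s2: "fst ` g (H k i) = fst ` g (H k j)" if "i \<in> {0, 1}" "j \<in> {0, 1}" "k \<in> {0, 1}" for i j k
    unfolding H_def insert_commute[of "(fst p, k)"]
    by (rule swap_unexceptional(1)[OF g _ b' _ _ _ that(1,2)])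
      (use R cR mem that in \<open>auto simp: card_insert_if\<close>)
  have snds: "snd p \<in> {0, 1}" "snd p' \<in> {0, 1}" using double_arrow_setD(1) p GA by blast+
  \<comment> \<open>\<open>G\<close> is one of the four sets and two swaps lead to any other, so all
    four images inherit the projection \<open>{a}\<close>.\<close>
  have "G = H (snd p) (snd p')" by (simp add: H_def RG)
  then have fibre: "fst ` g (H i j) = {a}" if "i \<in> {0, 1}" "j \<in> {0, 1}" for i j
    using s1[OF snds(1) that(1) snds(2)] s2[OF snds(2) that(2) that(1)] a by simp
  have "g (H i j) \<in> {{(a, 0)}, {(a, 1)}, {(a, 0), (a, 1)}}" if "i \<in> {0, 1}" "j \<in> {0, 1}" for i j
  proof (rule nonempty_subset_of_fibre)
    have "g (H i j) \<in> topspace ?Y"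
      using HY[OF that] continuous_map_image_subset_topspace[OF g] by blast
    then show "g (H i j) \<subseteq> double_arrow_set" "g (H i j) \<noteq> {}"
      by (auto simp: topspace_sym_product[OF t1_space_double_arrow] topspace_double_arrow)
  qed (use fibre that in simp)
  then have "g ` {H 0 0, H 0 1, H 1 0, H 1 1} \<subseteq> {{(a, 0)}, {(a, 1)}, {(a, 0), (a, 1)}}" by blast
  then have "card (g ` {H 0 0, H 0 1, H 1 0, H 1 1}) \<le> card {{(a, 0)}, {(a, 1)}, {(a, 0::real), (a, 1)}}"
    by (intro card_mono) auto
  also have "\<dots> \<le> 3" by (simp add: card_insert_if)
  also have "card (g ` {H 0 0, H 0 1, H 1 0, H 1 1}) = card {H 0 0, H 0 1, H 1 0, H 1 1}"
    using HY by (intro card_image inj_on_subset[OF inj]) auto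
  finally have "card {H 0 0, H 0 1, H 1 0, H 1 1} \<le> 3" .
  moreover have "H i j \<noteq> H i' j'" if "(i, j) \<noteq> (i', j')" for i j i' j'
  proof
    assume eq: "H i j = H i' j'"
    have "(fst p, i) \<in> H i' j'" "(fst p', j) \<in> H i' j'" unfolding eq[symmetric] by (auto simp: H_def)
    then show False using that ne RA by (fastforce simp: H_def)
  qed
  ultimately show False by (simp add: card_insert_if)
qed

theorem theorem1p1:
  fixes m :: nat
  assumes "m \<ge> 2"
  shows "\<not> homogeneous_space (sym_product m double_arrow)"
proof
  let ?Y = "sym_product m double_arrow"
  note topY = topspace_sym_product[OF t1_space_double_arrow] topspace_double_arrow
  assume hom: "homogeneous_space ?Y"
  obtain U where U: "openin ?Y U" "U \<noteq> {}" "\<And>G. G \<in> U \<Longrightarrow> card (fst ` G) = m"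
    using open_full_projection[of m] assms by auto
  then obtain Q where Q: "Q \<in> U" by blast
  then have "Q \<in> topspace ?Y" using openin_subset[OF U(1)] by blast
  moreover have "{(1, 0)} \<in> topspace ?Y" using assms by (simp add: topY double_arrow_set_iff)
  ultimately obtain h where h: "homeomorphic_map ?Y ?Y h" "h {(1, 0)} = Q"
    using hom unfolding homogeneous_space_def by blast
  then obtain g where hg: "homeomorphic_maps ?Y ?Y h g"
    by (auto simp: homeomorphic_map_maps)
  then have ch: "continuous_map ?Y ?Y h" and cg: "continuous_map ?Y ?Y g"
    and gh: "\<And>F. F \<in> topspace ?Y \<Longrightarrow> g (h F) = F" and hg': "\<And>F. F \<in> topspace ?Y \<Longrightarrow> h (g F) = F"
    by (auto simp: homeomorphic_maps_def)
  have injg: "inj_on g (topspace ?Y)" using hg' by (metis inj_onI)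
  \<comment> \<open>Adding the rationals makes \<open>D\<close> an admissible endpoint set for
    separation, and places 0 and 1 in \<open>D\<close>, so that points projecting outside
    \<open>D\<close> can be swapped.\<close>
  define D where "D = exceptional_set m g \<rat> \<union> \<rat>"
  define E where "E = exceptional_set m h D"
  have "countable D"
    unfolding D_def using countable_exceptional_set[OF cg countable_rat] countable_rat by auto
  then have cE: "countable E" unfolding E_def by (rule countable_exceptional_set[OF ch])
  \<comment> \<open>Parameters that are generic for \<open>h\<close> exist arbitrarily close to 1,
    as \<open>E\<close> is countable. The shift by 2 keeps them positive.\<close>
  have "\<exists>a. 1 - 1 / real (n + 2) < a \<and> a < 1 \<and> a \<notin> E" for n
  proof -
    have "uncountable {1 - 1 / real (n + 2)<..<1}" by (simp add: uncountable_open_interval)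
    then have "{1 - 1 / real (n + 2)<..<1} - E \<noteq> {}"
      using cE by (metis countable_empty uncountable_minus_countable)
    then show ?thesis by auto
  qed
  then obtain c where c: "\<And>n. 1 - 1 / real (n + 2) < c n" "\<And>n. c n < 1" "\<And>n. c n \<notin> E" by metis
  have "0 < c n" for n
  proof -
    have "1 / real (n + 2) < 1" by simp
    then show ?thesis using c(1)[of n] by linarith
  qed
  note c0 = this
  have limc: "c \<longlonglongrightarrow> 1"
  proof (rule tendsto_sandwich)
    show "(\<lambda>n. 1 - 1 / real (n + 2)) \<longlonglongrightarrow> 1"
      using tendsto_diff[OF tendsto_const[of 1] LIMSEQ_ignore_initial_segment[OF lim_1_over_n, of 2]] by simp
    show "(\<lambda>n. 1::real) \<longlonglongrightarrow> 1" by simp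
  qed (use c in \<open>auto intro: less_imp_le always_eventually\<close>)
  \<comment> \<open>The singleton \<open>{(1, 0)}\<close> is approached by generic singletons from
    the left, so by continuity some \<open>h {(c n, 0)}\<close> falls into the open set
    \<open>U\<close>.\<close>
  have lim1: "limitin double_arrow (\<lambda>n. (c n, 0)) (1, 0) sequentially"
    using c0 c(2) limc by (intro limitin_double_arrow_from_left) (auto simp: double_arrow_set_iff less_imp_le)
  have "limitin (vietoris double_arrow) (\<lambda>n. {(c n, 0)}) {(1, 0)} sequentially"
    by (rule limitin_vietoris_insert[OF t1_space_double_arrow _ lim1])
      (use c0 c(2) in \<open>auto simp: topspace_vietoris topspace_double_arrow double_arrow_set_iff less_imp_le\<close>)
  then have "limitin ?Y (\<lambda>n. {(c n, 0)}) {(1, 0)} sequentially"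
    using assms c0 c(2)
    by (simp add: sym_product_def limitin_subtopology topspace_double_arrow double_arrow_set_iff less_imp_le)
  then have "limitin ?Y (h \<circ> (\<lambda>n. {(c n, 0)})) Q sequentially"
    using continuous_map_limit[OF ch] h(2) by metis
  then have "\<forall>\<^sub>F n in sequentially. h {(c n, 0)} \<in> U"
    using U(1) Q by (simp add: limitin_def)
  then obtain n where n: "h {(c n, 0)} \<in> U"
    using eventually_happens'[OF sequentially_bot] by blast
  define a where "a = c n"
  have a: "0 < a" "a < 1" "a \<notin> E" and hU: "card (fst ` h {(a, 0)}) = m"
    using c(2,3) c0 U(3)[OF n] by (simp_all add: a_def)
  define S where "S = {{(a, 0)}, {(a, 1)}, {(a, 0), (a, 1::real)}}"
  have SY: "F \<in> topspace ?Y" if "F \<in> S" for F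
    using that a assms by (auto simp: S_def topY double_arrow_set_iff)
  have sw: "fst ` h F = fst ` h {(a, 0)}" "fst p \<in> D \<Longrightarrow> p \<in> h F \<longleftrightarrow> p \<in> h {(a, 0)}" if "F \<in> S" for F p
  proof -
    have D: "\<rat> \<subseteq> D" by (simp add: D_def)
    note sw = swap_unexceptional[OF ch D a(1,2) a(3)[unfolded E_def]]
    have sing: "{(a, 0)} \<subseteq> double_arrow_set" using a by (simp add: double_arrow_set_iff)
    have i: "(0::real) \<in> {0, 1}" "(1::real) \<in> {0, 1}" by auto
    have "fst ` h {(a, 1)} = fst ` h {(a, 0)}" "fst p \<in> D \<Longrightarrow> p \<in> h {(a, 1)} \<longleftrightarrow> p \<in> h {(a, 0)}" for p
      using sw[of "{}" 1 0] i assms by auto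
    \<comment> \<open>Here the common part is \<open>{(a, 0)}\<close>: inserting
      \<open>(a, 0)\<close> changes nothing, inserting \<open>(a, 1)\<close> gives the full fibre.
      Its cardinality 1 is below \<open>m\<close> because \<open>m\<close> is at least 2.\<close>
    moreover have "fst ` h {(a, 0), (a, 1)} = fst ` h {(a, 0)}"
      "fst p \<in> D \<Longrightarrow> p \<in> h {(a, 0), (a, 1)} \<longleftrightarrow> p \<in> h {(a, 0)}" for p
      using sw[of "{(a, 0)}" 1 0] i assms sing by (auto simp: insert_commute)
    ultimately show "fst ` h F = fst ` h {(a, 0)}" "fst p \<in> D \<Longrightarrow> p \<in> h F \<longleftrightarrow> p \<in> h {(a, 0)}"
      using that by (cases p, auto simp: S_def)+
  qed
  have hY: "h F \<in> topspace ?Y" if "F \<in> S" for F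
    using SY[OF that] continuous_map_image_subset_topspace[OF ch] by blast
  have hA: "h F \<subseteq> double_arrow_set" "inj_on fst (h F)" if "F \<in> S" for F
  proof -
    have "finite (h F)" "card (h F) \<le> m" using hY[OF that] by (auto simp: topY)
    moreover have "card (fst ` h F) = m" using sw(1)[OF that] hU by simp
    ultimately show "inj_on fst (h F)"
      by (metis card_image_le eq_card_imp_inj_on le_antisym)
    show "h F \<subseteq> double_arrow_set" using hY[OF that] by (auto simp: topY)
  qed
  have S0: "{(a, 0)} \<in> S" by (simp add: S_def)
  have free: "fst p = fst p'"
    if "p \<in> h {(a, 0)}" "p' \<in> h {(a, 0)}" "fst p \<notin> D" "fst p' \<notin> D" for p p'
  proof -
    have "0 < fst x \<and> fst x < 1" if "x \<in> h {(a, 0)}" "fst x \<notin> D" for x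
    proof -
      have "fst x \<noteq> 0" "fst x \<noteq> 1" using that(2) unfolding D_def by (metis Rats_0 Rats_1 UnI2)+
      moreover have "0 \<le> fst x" "fst x \<le> 1" using double_arrow_setD hA(1)[OF S0] that(1) by blast+
      ultimately show ?thesis by simp
    qed
    moreover have "fst ` g (h {(a, 0)}) = {a}" using gh[OF SY[OF S0]] by simp
    ultimately show ?thesis
      using unexceptional_projection_unique[OF cg injg hY[OF S0] hU] that by (auto simp: D_def)
  qed
  \<comment> \<open>\<open>d\<close> is the one projection that may lie outside \<open>D\<close>; it
    is arbitrary if there is none.\<close>
  have "\<exists>d. \<forall>p\<in>h {(a, 0)}. fst p \<notin> D \<longrightarrow> fst p = d"
    using free by blast
  then obtain d where d: "\<And>p. p \<in> h {(a, 0)} \<Longrightarrow> fst p \<notin> D \<Longrightarrow> fst p = d"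
    by blast
  \<comment> \<open>The images agree over \<open>D\<close>. A projection outside \<open>D\<close>
    can only be \<open>d\<close>, where each image has exactly one point; membership of
    \<open>(d, 0)\<close> tells which.\<close>
  have sub: "h F \<subseteq> h F'" if F: "F \<in> S" "F' \<in> S" and eq: "(d, 0) \<in> h F \<longleftrightarrow> (d, 0) \<in> h F'" for F F'
  proof
    fix p assume p: "p \<in> h F"
    show "p \<in> h F'"
    proof (cases "fst p \<in> D")
      case True
      then show ?thesis using sw(2)[OF F(1)] sw(2)[OF F(2)] p by blast
    next
      case False
      have "fst p \<in> fst ` h {(a, 0)}" "fst p \<in> fst ` h F'" using sw(1) F p by blast+
      then have "fst p = d" using d False by (auto simp: image_iff)
      obtain p' where p': "p' \<in> h F'" "fst p' = d" using \<open>fst p \<in> fst ` h F'\<close> \<open>fst p = d\<close> by auto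
      have "snd p = 0 \<or> snd p = 1" "snd p' = 0 \<or> snd p' = 1"
        using double_arrow_setD(1) hA(1) F p p' by blast+
      moreover have "snd p = 0 \<longleftrightarrow> (d, 0) \<in> h F"
        using hA(2)[OF F(1)] p \<open>fst p = d\<close> by (metis fst_conv inj_onD prod.collapse snd_conv)
      moreover have "snd p' = 0 \<longleftrightarrow> (d, 0) \<in> h F'"
        using hA(2)[OF F(2)] p' by (metis fst_conv inj_onD prod.collapse snd_conv)
      ultimately have "p = p'" using eq \<open>fst p = d\<close> p'(2) by (auto simp: prod_eq_iff)
      then show ?thesis using p' by simp
    qed
  qed
  have "F = F'" if "F \<in> S" "F' \<in> S" "(d, 0) \<in> h F \<longleftrightarrow> (d, 0) \<in> h F'" for F F'
  proof -
    have "h F = h F'" using sub[OF that] sub[OF that(2,1) that(3)[symmetric]] by (rule antisym)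
    then show ?thesis using gh[OF SY[OF that(1)]] gh[OF SY[OF that(2)]] by metis
  qed
  \<comment> \<open>Three sets would thus be told apart by a single truth value.\<close>
  then have "inj_on (\<lambda>F. (d, 0) \<in> h F) S" by (auto intro: inj_onI)
  then have "card S \<le> card (UNIV :: bool set)" by (rule card_inj_on_le) auto
  moreover have "card S = 3" by (auto simp: S_def card_insert_if doubleton_eq_iff)
  ultimately show False by simp
qed

end
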